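(* The functions $F$ and $Q$ have the same infimum. Moreover, let $(x^{\star},y^{\star})\in\mathrm{dom}(Q)$. Then $x^{\star}$ is a global minimizer of $F$ with $F(x^{\star})y^{\star}\in F(x^{\star})\,\partial g(x^{\star})$ if and only if $(x^{\star},y^{\star})$ is a global minimizer of $Q$.
   Context: Setting. $f,g,h:\mathbb{R}^n\to(-\infty,+\infty]$ are proper lower semicontinuous functions, $\Omega:=\{x\in\mathbb{R}^n: g(x)\neq 0\}$ is nonempty, and $f$ is block-separable: $f(x)=\sum_{i=1}^N f_i(x_i)$, where the subvectors $x_i\in\mathbb{R}^{n_i}$ form a partition of the components of $x$ and each $f_i:\mathbb{R}^{n_i}\to(-\infty,+\infty]$ is proper lower semicontinuous. Standing assumptions: (a) $f$ is continuous on $\mathrm{dom}(f)$ and each $f_i$ is bounded below; (b) $h$ is locally Lipschitz differentiable on $\Omega$, i.e. every $x\in\Omega$ has a neighborhood $\mathcal{B}(x)$ and a constant $L_x$ with $\|\nabla h(u)-\nabla h(v)\|_2\le L_x\|u-v\|_2$ for all $u,v\in\mathcal{B}(x)\cap\Omega$; (c) $g$ is convex, real-valued and nonnegative on $\mathbb{R}^n$; (d) $f+h\ge 0$ on $\mathrm{dom}(f)$. Notation. $\mathrm{dom}(\varphi)=\{x:\varphi(x)<+\infty\}$; $g^*(y)=\sup_x\{\langle x,y\rangle-g(x)\}$ is the Fenchel conjugate; $\partial g$ is the convex subdifferential; $\zeta(x):=f(x)+h(x)$; $\eta(x,y):=\langle x,y\rangle-g^*(y)$. $F:\mathbb{R}^n\to[0,+\infty]$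 is defined by $F(x)=\zeta(x)/g(x)$ if $x\in\Omega\cap\mathrm{dom}(f)$ and $F(x)=+\infty$ otherwise. $Q:\mathbb{R}^n\times\mathbb{R}^n\to[0,+\infty]$ is defined by $Q(x,y)=\zeta(x)/\eta(x,y)$ if $(x,y)\in\mathrm{dom}(f)\times\mathrm{dom}(g^* )$ and $\eta(x,y)>0$, and $Q(x,y)=+\infty$ otherwise. For a scalar $a$ and a set $S$, $aS=\{as:s\in S\}$. *)

theory Defs
  imports "HOL-Analysis.Analysis"
begin

definition edom :: "('a \<Rightarrow> ereal) \<Rightarrow> 'a set" where
  "edom \<phi> = {x. \<phi> x < \<infinity>}"

definition proper_on :: "'a set \<Rightarrow> ('a \<Rightarrow> ereal) \<Rightarrow> bool" where
  "proper_on S \<phi> \<longleftrightarrow> (\<forall>x\<in>S. \<phi> x \<noteq> -\<infinity>) \<and> (\<exists>x\<in>S. \<phi> x < \<infinity>)"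

definition lsc_on :: "'a::topological_space set \<Rightarrow> ('a \<Rightarrow> ereal) \<Rightarrow> bool" where
  "lsc_on S \<phi> \<longleftrightarrow> (\<forall>x\<in>S. \<phi> x \<le> Liminf (at x within S) \<phi>)"

text \<open>Subvectors indexed by a block \<open>J\<close> of coordinates are represented inside the full space by
  padding with zeros: \<open>block_space J\<close> is the isometric copy of \<open>\<real>\<^sup>J\<close> in \<open>\<real>\<^sup>n\<close>.
  A function on \<open>\<real>\<^sup>J\<close> is a function on the full space of which only the values on
  \<open>block_space J\<close> are used.\<close>

definition block_space :: "'n::finite set \<Rightarrow> (real^'n) set" where
  "block_space J = {z. \<forall>j. j \<notin> J \<longrightarrow> z $ j = 0}"

definition subvector :: "'n::finite set \<Rightarrow> real^'n \<Rightarrow> real^'n" where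
  "subvector J x = (\<chi> j. if j \<in> J then x $ j else 0)"

text \<open>The gradient at a point around which \<open>\<phi>\<close> is finite; the finiteness requirement
  rules out derivatives created by \<^const>\<open>real_of_ereal\<close> sending infinities to zero.\<close>

definition has_gradient :: "('a::real_inner \<Rightarrow> ereal) \<Rightarrow> 'a \<Rightarrow> 'a \<Rightarrow> bool" where
  "has_gradient \<phi> x D \<longleftrightarrow>
     (\<forall>\<^sub>F u in nhds x. \<bar>\<phi> u\<bar> \<noteq> \<infinity>) \<and> GDERIV (\<lambda>u. real_of_ereal (\<phi> u)) x :> D"

definition locally_Lipschitz_differentiable_on ::
    "'a::real_inner set \<Rightarrow> ('a \<Rightarrow> ereal) \<Rightarrow> bool" where
  "locally_Lipschitz_differentiable_on S \<phi> \<longleftrightarrow>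
     (\<exists>G. (\<forall>x\<in>S. has_gradient \<phi> x (G x)) \<and>
          (\<forall>x\<in>S. \<exists>B L. open B \<and> x \<in> B \<and>
             (\<forall>u\<in>B \<inter> S. \<forall>v\<in>B \<inter> S. norm (G u - G v) \<le> L * norm (u - v))))"

definition fenchel_conjugate :: "('a::real_inner \<Rightarrow> ereal) \<Rightarrow> 'a \<Rightarrow> ereal" where
  "fenchel_conjugate g y = (SUP x. ereal (x \<bullet> y) - g x)"

definition subdifferential :: "('a::real_inner \<Rightarrow> ereal) \<Rightarrow> 'a \<Rightarrow> 'a set" where
  "subdifferential g x =
     {v. \<bar>g x\<bar> \<noteq> \<infinity> \<and> (\<forall>z. g x + ereal (v \<bullet> (z - x)) \<le> g z)}"

definition zeta :: "('a \<Rightarrow> ereal) \<Rightarrow> ('a \<Rightarrow> ereal) \<Rightarrow> 'a \<Rightarrow> ereal" where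
  "zeta f h x = f x + h x"

definition eta :: "('a::real_inner \<Rightarrow> ereal) \<Rightarrow> 'a \<Rightarrow> 'a \<Rightarrow> ereal" where
  "eta g x y = ereal (x \<bullet> y) - fenchel_conjugate g y"

definition Omega :: "('a \<Rightarrow> ereal) \<Rightarrow> 'a set" where
  "Omega g = {x. g x \<noteq> 0}"

definition F_obj :: "('a \<Rightarrow> ereal) \<Rightarrow> ('a \<Rightarrow> ereal) \<Rightarrow> ('a \<Rightarrow> ereal) \<Rightarrow> 'a \<Rightarrow> ereal" where
  "F_obj f g h x = (if x \<in> Omega g \<inter> edom f then zeta f h x / g x else \<infinity>)"

definition Q_obj ::
    "('a::real_inner \<Rightarrow> ereal) \<Rightarrow> ('a \<Rightarrow> ereal) \<Rightarrow> ('a \<Rightarrow> ereal) \<Rightarrow> 'a \<times> 'a \<Rightarrow> ereal" where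
  "Q_obj f g h = (\<lambda>(x, y).
     if (x, y) \<in> edom f \<times> edom (fenchel_conjugate g) \<and> eta g x y > 0
     then zeta f h x / eta g x y else \<infinity>)"

definition global_minimizer :: "('a \<Rightarrow> ereal) \<Rightarrow> 'a \<Rightarrow> bool" where
  "global_minimizer \<phi> x \<longleftrightarrow> (\<forall>z. \<phi> x \<le> \<phi> z)"

end

theory Submission
  imports Defs
begin

text \<open>By Fenchel--Young \<open>\<eta>(x, y) \<le> g(x)\<close>, with equality exactly for subgradients \<open>y\<close> of \<open>g\<close> at
  \<open>x\<close>, and subgradients always exist since \<open>g\<close> is convex and finite. As \<open>\<zeta> \<ge> 0\<close> on the domain
  of \<open>f\<close>, this gives \<open>F(x) = min\<^sub>y Q(x, y)\<close>, attained at the subgradients, and, when \<open>0 < F(x) < \<infinity>\<close>,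
  only there. The factor \<open>F(x)\<close> in the inclusion makes it vacuous when \<open>F(x) = 0\<close>.\<close>

text \<open>Separate the graph point \<open>(x, \<phi> x)\<close> from the convex strict epigraph
  \<open>T\<close>. The normal \<open>(a, b)\<close> of the hyperplane has \<open>b > 0\<close>, and
  solving for the last coordinate turns it into the subgradient
  \<open>- a /\<^sub>R b\<close>.\<close>

lemma convex_on_subgradient_exists:
  fixes \<phi> :: "'a::euclidean_space \<Rightarrow> real"
  assumes "convex_on UNIV \<phi>"
  obtains v where "\<And>z. \<phi> x + v \<bullet> (z - x) \<le> \<phi> z"
proof -
  define T where "T = {(z, t). \<phi> z < t}"
  have "convex T"
    unfolding convex_alt
  proof (clarsimp simp: T_def)
    fix s t u :: real and p q :: 'a
    assume "\<phi> p < s" "\<phi> q < t" "0 \<le> u" "u \<le> 1"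
    then have "(1 - u) * \<phi> p + u * \<phi> q < (1 - u) * s + u * t"
      \<comment> \<open>Strictness comes from the \<open>q\<close> term when \<open>u > 0\<close>
        and from the \<open>p\<close> term when \<open>u = 0\<close>.\<close>
      by (cases "u = 0") (auto intro!: add_le_less_mono mult_left_mono)
    moreover have "\<phi> ((1 - u) *\<^sub>R p + u *\<^sub>R q) \<le> (1 - u) * \<phi> p + u * \<phi> q"
      using convex_onD[OF assms] \<open>0 \<le> u\<close> \<open>u \<le> 1\<close> by simp
    ultimately show "\<phi> ((1 - u) *\<^sub>R p + u *\<^sub>R q) < (1 - u) * s + u * t"
      by linarith
  qed
  moreover have "T \<noteq> {}" "{(x, \<phi> x)} \<inter> T = {}"
    by (auto simp: T_def intro: gt_ex)
  ultimately obtain c k where "c \<noteq> 0"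
    and le: "c \<bullet> (x, \<phi> x) \<le> k" and ge: "\<forall>p\<in>T. k \<le> c \<bullet> p"
    using separating_hyperplane_sets[of "{(x, \<phi> x)}" T] by (metis convex_singleton insert_not_empty singletonI)
  obtain a b where c: "c = (a, b)"
    by (cases c)
  have sep: "a \<bullet> x + b * \<phi> x \<le> a \<bullet> z + b * t" if "\<phi> z < t" for z t
    using le ge that by (force simp: T_def c inner_Pair)
  have "b \<ge> 0"
    using sep[of x "\<phi> x + 1"] by (simp add: algebra_simps)
  \<comment> \<open>The hyperplane is not vertical: \<phi> is finite everywhere, so with
    \<open>b = 0\<close> the separation would bound \<open>a \<bullet> z\<close> below over the
    whole space. Moving from \<open>x\<close> against \<open>a\<close> contradicts this unless
    \<open>a = 0\<close>.\<close>
  moreover have "b \<noteq> 0"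
  proof
    assume "b = 0"
    then have "a \<bullet> x \<le> a \<bullet> (x - a)"
      using sep[of "x - a" "\<phi> (x - a) + 1"] by simp
    then have "a \<bullet> a \<le> 0"
      by (simp add: inner_diff_right)
    then have "a = 0"
      by (metis inner_gt_zero_iff not_less)
    with \<open>b = 0\<close> \<open>c \<noteq> 0\<close> show False
      by (simp add: c zero_prod_def)
  qed
  ultimately have "b > 0"
    by simp
  have "\<phi> x + (- a /\<^sub>R b) \<bullet> (z - x) \<le> \<phi> z" for z
  \<comment> \<open>\<open>sep\<close> applies only strictly above the graph, hence at height
    \<open>\<phi> z + e\<close> for arbitrary \<open>e > 0\<close>.\<close>
  proof (rule field_le_epsilon)
    fix e :: real assume "e > 0"
    then have "a \<bullet> x + b * \<phi> x \<le> a \<bullet> z + b * (\<phi> z + e)"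
      by (intro sep) simp
    with \<open>b > 0\<close> show "\<phi> x + (- a /\<^sub>R b) \<bullet> (z - x) \<le> \<phi> z + e"
      by (simp add: field_simps inner_diff_right)
  qed
  then show ?thesis
    by (rule that)
qed

lemma subdifferential_nonempty:
  fixes g :: "'a::euclidean_space \<Rightarrow> ereal"
  assumes "\<forall>x. \<bar>g x\<bar> \<noteq> \<infinity>" "convex_on UNIV (\<lambda>x. real_of_ereal (g x))"
  shows "subdifferential g x \<noteq> {}"
proof -
  obtain v where v: "\<And>z. real_of_ereal (g x) + v \<bullet> (z - x) \<le> real_of_ereal (g z)"
    using convex_on_subgradient_exists[OF assms(2), of x] by blast
  have "g x + ereal (v \<bullet> (z - x)) \<le> g z" for z
    using v[of z] assms(1) ereal_real'[of "g x"] ereal_real'[of "g z"]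
    by (metis ereal_less_eq(3) plus_ereal.simps(1))
  then have "v \<in> subdifferential g x"
    using assms(1) by (simp add: subdifferential_def)
  then show ?thesis
    by blast
qed

lemma eta_le:
  assumes "\<bar>g x\<bar> \<noteq> \<infinity>"
  shows "eta g x y \<le> g x"
proof -
  have "ereal (x \<bullet> y) - g x \<le> fenchel_conjugate g y"
    unfolding fenchel_conjugate_def by (rule SUP_upper) simp
  with assms show ?thesis
    unfolding eta_def by (cases "g x"; cases "fenchel_conjugate g y") auto
qed

text \<open>Equality means that \<open>x\<close> attains the supremum defining the conjugate at
  \<open>y\<close>; written out for every competitor \<open>z\<close>, this is the subgradient
  inequality.\<close>

lemma eta_eq_iff_subdifferential:
  assumes g_real: "\<forall>x. \<bar>g x\<bar> \<noteq> \<infinity>"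
  shows "eta g x y = g x \<longleftrightarrow> y \<in> subdifferential g x"
proof -
  define \<phi> where "\<phi> x = real_of_ereal (g x)" for x
  have \<phi>: "g = (\<lambda>x. ereal (\<phi> x))"
    using g_real by (auto simp: \<phi>_def ereal_real')
  have "eta g x y = g x \<longleftrightarrow> g x \<le> eta g x y"
    using eta_le[of g x y] g_real by auto
  also have "\<dots> \<longleftrightarrow> fenchel_conjugate g y \<le> ereal (x \<bullet> y - \<phi> x)"
    unfolding eta_def \<phi> by (cases "fenchel_conjugate (\<lambda>x. ereal (\<phi> x)) y") auto
  also have "\<dots> \<longleftrightarrow> (\<forall>z. z \<bullet> y - \<phi> z \<le> x \<bullet> y - \<phi> x)"
    unfolding fenchel_conjugate_def \<phi> by (simp add: SUP_le_iff)
  also have "\<dots> \<longleftrightarrow> (\<forall>z. \<phi> x + y \<bullet> (z - x) \<le> \<phi> z)"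
    by (intro all_cong1) (auto simp: inner_diff_right inner_commute)
  also have "\<dots> \<longleftrightarrow> y \<in> subdifferential g x"
    by (simp add: subdifferential_def \<phi>)
  finally show ?thesis .
qed

lemma subdifferential_subset_edom_conjugate:
  assumes "\<forall>x. \<bar>g x\<bar> \<noteq> \<infinity>"
  shows "subdifferential g x \<subseteq> edom (fenchel_conjugate g)"
proof
  fix y assume "y \<in> subdifferential g x"
  then have "\<bar>eta g x y\<bar> \<noteq> \<infinity>"
    using assms by (simp flip: eta_eq_iff_subdifferential)
  then show "y \<in> edom (fenchel_conjugate g)"
    by (cases "fenchel_conjugate g y") (auto simp: eta_def edom_def)
qed

lemma F_obj_nonneg:
  assumes "\<forall>x. 0 \<le> g x" "\<forall>x\<in>edom f. 0 \<le> f x + h x"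
  shows "0 \<le> F_obj f g h x"
  using assms by (simp add: F_obj_def zeta_def)

lemma Q_obj_finiteD:
  assumes "\<forall>x. \<bar>g x\<bar> \<noteq> \<infinity>" "Q_obj f g h (x, y) < \<infinity>"
  shows "x \<in> Omega g \<inter> edom f" "0 < eta g x y" "Q_obj f g h (x, y) = zeta f h x / eta g x y"
proof -
  show "0 < eta g x y" "Q_obj f g h (x, y) = zeta f h x / eta g x y"
    using assms(2) by (auto simp: Q_obj_def split: if_splits)
  moreover have "x \<in> edom f"
    using assms(2) by (auto simp: Q_obj_def split: if_splits)
  ultimately show "x \<in> Omega g \<inter> edom f"
    using eta_le[of g x y] assms(1) by (auto simp: Omega_def)
qed

text \<open>Where \<open>Q_obj\<close> is finite, both quotients share a nonnegative numerator, and
  the denominators satisfy \<open>0 < eta g x y \<le> g x\<close>.\<close>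

lemma F_obj_le_Q_obj:
  assumes g_real: "\<forall>x. \<bar>g x\<bar> \<noteq> \<infinity>" and nonneg: "\<forall>x\<in>edom f. 0 \<le> f x + h x"
  shows "F_obj f g h x \<le> Q_obj f g h (x, y)"
proof (cases "Q_obj f g h (x, y) < \<infinity>")
  case True
  note Q = Q_obj_finiteD[OF g_real True]
  have "0 \<le> zeta f h x"
    using nonneg Q(1) by (simp add: zeta_def)
  then have "zeta f h x / g x \<le> zeta f h x / eta g x y"
    using eta_le[of g x y] g_real Q(2)
    by (auto simp: divide_ereal_def intro!: ereal_mult_left_mono ereal_inverse_antimono)
  with Q show ?thesis
    by (simp add: F_obj_def)
qed auto

text \<open>Since \<open>eta g x y = g x\<close>, the two case distinctions agree as well as the
  quotients: where \<open>g x = 0\<close> or \<open>f x\<close> is infinite, both sides are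
  infinite.\<close>

lemma Q_obj_subgradient:
  assumes g_real: "\<forall>x. \<bar>g x\<bar> \<noteq> \<infinity>" and g_nonneg: "\<forall>x. 0 \<le> g x"
    and y: "y \<in> subdifferential g x"
  shows "Q_obj f g h (x, y) = F_obj f g h x"
proof -
  have "eta g x y = g x"
    using y g_real by (simp add: eta_eq_iff_subdifferential)
  moreover have "y \<in> edom (fenchel_conjugate g)"
    using subdifferential_subset_edom_conjugate[OF g_real] y by blast
  ultimately show ?thesis
    using g_nonneg by (auto simp: Q_obj_def F_obj_def Omega_def less_le)
qed

theorem proposition3p1:
  fixes f g h :: "real^'n \<Rightarrow> ereal"
    and N :: nat
    and B :: "nat \<Rightarrow> 'n set"
    and fs :: "nat \<Rightarrow> real^'n \<Rightarrow> ereal"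
  assumes f_proper_lsc: "proper_on UNIV f" "lsc_on UNIV f"
    and g_proper_lsc: "proper_on UNIV g" "lsc_on UNIV g"
    and h_proper_lsc: "proper_on UNIV h" "lsc_on UNIV h"
    and Omega_nonempty: "Omega g \<noteq> {}"
    and blocks: "\<forall>i\<in>{1..N}. B i \<noteq> {}" "disjoint_family_on B {1..N}" "(\<Union>i\<in>{1..N}. B i) = UNIV"
    and fs_proper_lsc: "\<forall>i\<in>{1..N}. proper_on (block_space (B i)) (fs i) \<and> lsc_on (block_space (B i)) (fs i)"
    and f_separable: "\<forall>x. f x = (\<Sum>i=1..N. fs i (subvector (B i) x))"
    and f_continuous: "continuous_on (edom f) f"
    and fs_bounded_below: "\<forall>i\<in>{1..N}. \<exists>c::real. \<forall>z\<in>block_space (B i). ereal c \<le> fs i z"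
    and h_smooth: "locally_Lipschitz_differentiable_on (Omega g) h"
    and g_real: "\<forall>x. \<bar>g x\<bar> \<noteq> \<infinity>"
    and g_nonneg: "\<forall>x. 0 \<le> g x"
    and g_convex: "convex_on UNIV (\<lambda>x. real_of_ereal (g x))"
    and fh_nonneg: "\<forall>x\<in>edom f. 0 \<le> f x + h x"
  shows "(INF x. F_obj f g h x) = (INF p. Q_obj f g h p) \<and>
    (\<forall>x y. (x, y) \<in> edom (Q_obj f g h) \<longrightarrow>
       ((global_minimizer (F_obj f g h) x \<and>
         real_of_ereal (F_obj f g h x) *\<^sub>R y
           \<in> (\<lambda>v. real_of_ereal (F_obj f g h x) *\<^sub>R v) ` subdifferential g x)
        \<longleftrightarrow> global_minimizer (Q_obj f g h) (x, y)))"
proof (intro conjI allI impI)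
  let ?F = "F_obj f g h" and ?Q = "Q_obj f g h"
  note le = F_obj_le_Q_obj[OF g_real fh_nonneg]
  have attained: "\<exists>y. ?Q (x, y) = ?F x" for x
    using subdifferential_nonempty[OF g_real g_convex, of x] Q_obj_subgradient[OF g_real g_nonneg]
    by blast
  show "(INF x. ?F x) = (INF p. ?Q p)"
  proof (rule antisym)
    show "(INF x. ?F x) \<le> (INF p. ?Q p)"
      by (rule INF_mono) (use le in auto)
    show "(INF p. ?Q p) \<le> (INF x. ?F x)"
      by (rule INF_mono) (metis UNIV_I attained order_refl)
  qed
  fix x y assume "(x, y) \<in> edom ?Q"
  then have fin: "?Q (x, y) < \<infinity>"
    by (simp add: edom_def)
  note Q = Q_obj_finiteD[OF g_real fin]
  have F: "?F x = zeta f h x / g x"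
    using Q(1) by (simp add: F_obj_def)
  have "?F x < \<infinity>"
    using le fin by (rule le_less_trans)
  then obtain r where r: "?F x = ereal r"
    using F_obj_nonneg[OF g_nonneg fh_nonneg, of x] by (cases "?F x") auto
  obtain b where b: "g x = ereal b" "b > 0"
    using Q(1) spec[OF g_real, of x] spec[OF g_nonneg, of x]
    by (cases "g x") (auto simp: Omega_def less_le)
  obtain d where d: "eta g x y = ereal d" "d > 0"
    using Q(2) eta_le[of g x y] b by (cases "eta g x y") auto
  have z: "zeta f h x = ereal (r * b)"
    using F r b by (cases "zeta f h x") (auto simp: field_simps)
  have Qval: "?Q (x, y) = ereal (r * b / d)"
    using Q(3) z d by simp
  \<comment> \<open>The values are \<open>r * b / d\<close> and \<open>r\<close>, so they agree iff
    \<open>r = 0\<close> or \<open>d = b\<close>; the latter is equality in Fenchel--Young.\<close>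
  have Q_eq_F: "?Q (x, y) = ?F x \<longleftrightarrow> r = 0 \<or> y \<in> subdifferential g x"
    using b d by (auto simp: Qval r field_simps simp flip: eta_eq_iff_subdifferential[OF g_real])
  \<comment> \<open>Minimizing \<open>?Q\<close> over its second argument first gives
    \<open>?F\<close>, so a joint minimizer is a minimizer of \<open>?F\<close> at whose
    \<open>x\<close> the inner minimum is attained by \<open>y\<close>.\<close>
  have "global_minimizer ?Q (x, y) \<longleftrightarrow> global_minimizer ?F x \<and> ?Q (x, y) = ?F x"
  proof (intro iffI conjI)
    assume min: "global_minimizer ?Q (x, y)"
    then have "?Q (x, y) \<le> ?F z" for z
      using attained[of z] by (metis global_minimizer_def)
    then show "?Q (x, y) = ?F x" "global_minimizer ?F x"
      using le[of x y] by (auto simp: global_minimizer_def intro: antisym order_trans)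
  next
    assume "global_minimizer ?F x \<and> ?Q (x, y) = ?F x"
    then have "?Q (x, y) \<le> ?Q (u, v)" for u v
      using le[of u v] by (auto simp: global_minimizer_def intro: order_trans)
    then show "global_minimizer ?Q (x, y)"
      by (simp add: global_minimizer_def)
  qed
  \<comment> \<open>For \<open>r \<noteq> 0\<close> scaling is injective. For \<open>r = 0\<close>
    the image is the singleton of zero, because the subdifferential is nonempty.\<close>
  moreover have "r *\<^sub>R y \<in> (\<lambda>v. r *\<^sub>R v) ` subdifferential g x \<longleftrightarrow> r = 0 \<or> y \<in> subdifferential g x"
    using subdifferential_nonempty[OF g_real g_convex, of x] by auto
  ultimately show "global_minimizer ?F x \<and>
      real_of_ereal (?F x) *\<^sub>R y \<in> (\<lambda>v. real_of_ereal (?F x) *\<^sub>R v) ` subdifferential g x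
      \<longleftrightarrow> global_minimizer ?Q (x, y)"
    using Q_eq_F r by simp
qed

end
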